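(* Let $0<a<b$, let $D=D_{a,b}=\{x\in\mathbb{R}^2:a\le|x|\le b\}$ be a circular annulus, and let $I_0(x)=\Phi(\operatorname{dist}(x,D))$ for $x\in\Omega_{\rm inv}$, where $\Phi$ is continuous and strictly decreasing on the relevant distance range and satisfies $\Phi(0)=1$. Assume that $\Omega_{\rm inv}$ contains an exterior point (a point $x$ with $|x|>b$) whose distance from $D$ is greater than $a$. Then the cavity component in the global sublevel filtration of $I_0$ gives a finite $H_0$ bar with $$b_{\rm cav}=\Phi(a),\qquad d_{\rm cav}=1,\qquad p_{\rm cav}=1-\Phi(a).$$ In particular, $p_{\rm cav}$ is strictly increasing with the hole radius $a$.
   Context: $\Omega_{\rm inv}\subset\mathbb{R}^2$ is a bounded imaging window, chosen large enough that the superlevel sets relevant to the reconstruction do not meet $\partial\Omega_{\rm inv}$. The function $I_0$ is an idealized indicator modelling spatial blurring of the scatterer $D$, and $\operatorname{dist}(x,D)$ is the Euclidean distance from $x$ to $D$. The global sublevel filtration of $I_0$ is the family of sets $\{x\in\Omega_{\rm inv}:I_0(x)\le t\}$, which grows as $t$ increases. Its zero-dimensional persistent homology ($H_0$, coefficients in $\mathbb{F}_2$) tracks connected components. A bar $[b,d)$ records a component born at level $b$ that, by the elder rule, dies at level $d$ by merging with a component born at a lower level. A class that never dies is called essential, and bars with $d<\infty$ are called finite. The persistence of a finite bar is $p=d-b$. The cavity component is the component born inside the hole $\{|x|<a\}$; $b_{\rm cav}$, $d_{\rm cav}$ and $p_{\rm cav}=d_{\rm cav}-b_{\rm cav}$ denote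 its birth level, death level and persistence.
   Formalization: The window Ω_inv is additionally assumed path connected and to contain the closed disc |x|≤b in its interior; if the far exterior point lay in a separate piece of the window, the cavity class could be essential and the claim would fail. *)

theory Defs
  imports "HOL-Homology.Homology" "HOL-Library.Z2"
begin

text \<open>
  Singular homology with coefficients in the two-element field, built on the library's singular
  simplices. (HOL-Homology itself only provides integer coefficients.) The signs in the
  boundary formula disappear modulo 2. A homology class is the coset of all cycles homologous to
  a given one.
\<close>

type_synonym 'a mod2_chain = "((nat \<Rightarrow> real) \<Rightarrow> 'a) \<Rightarrow>\<^sub>0 bit"

definition mod2_chains :: "nat \<Rightarrow> 'a topology \<Rightarrow> 'a mod2_chain set" where
  "mod2_chains p X = {c. Poly_Mapping.keys c \<subseteq> singular_simplex_set p X}"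

definition mod2_boundary :: "nat \<Rightarrow> 'a mod2_chain \<Rightarrow> 'a mod2_chain" where
  "mod2_boundary p c =
     (if p = 0 then 0
      else \<Sum>\<sigma>\<in>Poly_Mapping.keys c. \<Sum>k\<le>p.
             Poly_Mapping.single (singular_face p k \<sigma>) (Poly_Mapping.lookup c \<sigma>))"

definition mod2_cycles :: "nat \<Rightarrow> 'a topology \<Rightarrow> 'a mod2_chain set" where
  "mod2_cycles p X = {c \<in> mod2_chains p X. mod2_boundary p c = 0}"

definition mod2_boundaries :: "nat \<Rightarrow> 'a topology \<Rightarrow> 'a mod2_chain set" where
  "mod2_boundaries p X = mod2_boundary (Suc p) ` mod2_chains (Suc p) X"

definition mod2_class :: "nat \<Rightarrow> 'a topology \<Rightarrow> 'a mod2_chain \<Rightarrow> 'a mod2_chain set" where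
  "mod2_class p X c = {c' \<in> mod2_cycles p X. c' - c \<in> mod2_boundaries p X}"

definition mod2_homology :: "nat \<Rightarrow> 'a topology \<Rightarrow> 'a mod2_chain set set" where
  "mod2_homology p X = mod2_class p X ` mod2_cycles p X"

text \<open>
  The map into the homology of \<open>Y\<close> induced by the inclusion of a subspace of \<open>Y\<close>, applied to a
  class \<open>\<alpha>\<close> of that subspace.
\<close>

definition mod2_incl :: "nat \<Rightarrow> 'a topology \<Rightarrow> 'a mod2_chain set \<Rightarrow> 'a mod2_chain set" where
  "mod2_incl p Y \<alpha> = (\<Union>c\<in>\<alpha>. mod2_class p Y c)"

definition sublevel_filtration ::
    "'a::topological_space set \<Rightarrow> ('a \<Rightarrow> real) \<Rightarrow> real \<Rightarrow> 'a topology" where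
  "sublevel_filtration \<Omega> f t = top_of_set {x \<in> \<Omega>. f x \<le> t}"

text \<open>
  Persistent homology of an increasing family \<open>F\<close> of subspaces. The set \<open>older_classes p F \<beta> t\<close>
  consists of the classes at level \<open>t\<close> that already come from some level strictly below \<open>\<beta>\<close>; it
  contains the zero class, since some (possibly empty) space precedes \<open>\<beta>\<close>.
\<close>

definition older_classes ::
    "nat \<Rightarrow> (real \<Rightarrow> 'a topology) \<Rightarrow> real \<Rightarrow> real \<Rightarrow> 'a mod2_chain set set" where
  "older_classes p F \<beta> t = (\<Union>s\<in>{..<\<beta>}. mod2_incl p (F t) ` mod2_homology p (F s))"

definition born_at :: "nat \<Rightarrow> (real \<Rightarrow> 'a topology) \<Rightarrow> 'a mod2_chain set \<Rightarrow> real \<Rightarrow> bool" where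
  "born_at p F \<alpha> \<beta> \<longleftrightarrow> \<alpha> \<in> mod2_homology p (F \<beta>) \<and> \<alpha> \<notin> older_classes p F \<beta> \<beta>"

text \<open>
  The elder rule: a class born at \<open>\<beta>\<close> dies at the first level at which it becomes equal to a class
  born strictly before \<open>\<beta>\<close>. It then contributes the finite bar \<open>[\<beta>, \<delta>)\<close>; if there is no such
  \<open>\<delta>\<close>, the class is essential.
\<close>

definition dies_at ::
    "nat \<Rightarrow> (real \<Rightarrow> 'a topology) \<Rightarrow> 'a mod2_chain set \<Rightarrow> real \<Rightarrow> real \<Rightarrow> bool" where
  "dies_at p F \<alpha> \<beta> \<delta> \<longleftrightarrow>
     \<beta> < \<delta> \<and> (\<forall>t\<in>{\<beta>..<\<delta>}. mod2_incl p (F t) \<alpha> \<notin> older_classes p F \<beta> t) \<and>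
     mod2_incl p (F \<delta>) \<alpha> \<in> older_classes p F \<beta> \<delta>"

definition finite_bar ::
    "nat \<Rightarrow> (real \<Rightarrow> 'a topology) \<Rightarrow> 'a mod2_chain set \<Rightarrow> real \<Rightarrow> real \<Rightarrow> bool" where
  "finite_bar p F \<alpha> \<beta> \<delta> \<longleftrightarrow> born_at p F \<alpha> \<beta> \<and> dies_at p F \<alpha> \<beta> \<delta>"

text \<open>
  The degree-zero class of a path component is the class of any of its points, regarded as a
  singular 0-simplex. The choice of the point does not matter.
\<close>

definition point_simplex :: "'a \<Rightarrow> (nat \<Rightarrow> real) \<Rightarrow> 'a" where
  "point_simplex x = restrict (\<lambda>_. x) (standard_simplex 0)"

definition component_class :: "'a topology \<Rightarrow> 'a set \<Rightarrow> 'a mod2_chain set" where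
  "component_class X C = mod2_class 0 X (Poly_Mapping.single (point_simplex (SOME x. x \<in> C)) 1)"

definition annulus :: "real \<Rightarrow> real \<Rightarrow> (real ^ 2) set" where
  "annulus a b = {x. a \<le> norm x \<and> norm x \<le> b}"

definition ideal_indicator :: "(real \<Rightarrow> real) \<Rightarrow> (real ^ 2) set \<Rightarrow> real ^ 2 \<Rightarrow> real" where
  "ideal_indicator \<Phi> D x = \<Phi> (infdist x D)"

definition indicator_filtration ::
    "(real \<Rightarrow> real) \<Rightarrow> (real ^ 2) set \<Rightarrow> real \<Rightarrow> real \<Rightarrow> real \<Rightarrow> (real ^ 2) topology" where
  "indicator_filtration \<Phi> \<Omega> a b = sublevel_filtration \<Omega> (ideal_indicator \<Phi> (annulus a b))"

text \<open>
  The imaging window \<open>\<Omega>\<close> is bounded and in one piece, and the scatterer together with its hole lies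
  in the interior of \<open>\<Omega>\<close>. In particular the superlevel set at height 1, which is the annulus, does
  not meet the boundary of \<open>\<Omega>\<close>. The relevant distance range of \<open>\<Phi>\<close> is the set of distances to the
  annulus that occur in \<open>\<Omega>\<close>.
\<close>

definition annular_configuration ::
    "(real \<Rightarrow> real) \<Rightarrow> (real ^ 2) set \<Rightarrow> real \<Rightarrow> real \<Rightarrow> bool" where
  "annular_configuration \<Phi> \<Omega> a b \<longleftrightarrow>
     0 < a \<and> a < b \<and>
     bounded \<Omega> \<and> path_connected \<Omega> \<and> cball 0 b \<subseteq> interior \<Omega> \<and>
     continuous_on ((\<lambda>x. infdist x (annulus a b)) ` \<Omega>) \<Phi> \<and>
     strict_antimono_on ((\<lambda>x. infdist x (annulus a b)) ` \<Omega>) \<Phi> \<and>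
     \<Phi> 0 = 1 \<and>
     (\<exists>x\<in>\<Omega>. norm x > b \<and> infdist x (annulus a b) > a)"

text \<open>
  A cavity component, with its birth level \<open>\<beta>\<close>, is a component that is born at \<open>\<beta>\<close> inside the hole.
  The descriptions below refer to the cavity component; they are meaningful when it is unique.
\<close>

definition cavity_component ::
    "real \<Rightarrow> (real \<Rightarrow> (real ^ 2) topology) \<Rightarrow> (real ^ 2) set \<Rightarrow> real \<Rightarrow> bool" where
  "cavity_component a F C \<beta> \<longleftrightarrow>
     C \<in> path_components_of (F \<beta>) \<and> C \<subseteq> {x. norm x < a} \<and>
     born_at 0 F (component_class (F \<beta>) C) \<beta>"

definition cavity_birth :: "real \<Rightarrow> (real \<Rightarrow> (real ^ 2) topology) \<Rightarrow> real" where
  "cavity_birth a F = (THE \<beta>. \<exists>C. cavity_component a F C \<beta>)"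

definition cavity_death :: "real \<Rightarrow> (real \<Rightarrow> (real ^ 2) topology) \<Rightarrow> real" where
  "cavity_death a F =
     (THE \<delta>. \<exists>C \<beta>. cavity_component a F C \<beta> \<and> dies_at 0 F (component_class (F \<beta>) C) \<beta> \<delta>)"

definition cavity_persistence :: "real \<Rightarrow> (real \<Rightarrow> (real ^ 2) topology) \<Rightarrow> real" where
  "cavity_persistence a F = cavity_death a F - cavity_birth a F"

end

(*
The parity of the number of points of a 0-chain in a clopen subset A of a space is unchanged by
adding boundaries, since every path stays inside A or outside A. Below level 1 the sublevel
sets avoid the annulus, so the hole is clopen in them. The class of the origin has parity 1 in the
hole, whereas 0-chains from levels below \<Phi> a have no points in the hole: the distance to the
annulus is at most a there, with equality only at the origin. At level 1 the sublevel set is all of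
the path connected window, and the origin is joined to the exterior point at distance greater than
a, which is older.

Every other component contained in the hole is not new, because a point of the hole is joined to
the origin through points farther from the annulus.
*)

theory Submission
  imports Defs "HOL-Analysis.Abstract_Topological_Spaces"
begin

section \<open>Algebra of mod 2 chains, classes and inclusions\<close>

lemma mod2_chain_uminus [simp]: "- c = (c :: 'a mod2_chain)"
  by (rule poly_mapping_eqI) (simp add: uminus_bit_def)

lemma mod2_boundary_add: "mod2_boundary p (c + d) = mod2_boundary p c + mod2_boundary p d"
proof (cases "p = 0")
  case False
  have "(\<Sum>\<sigma>\<in>Poly_Mapping.keys (c + d). \<Sum>k\<le>p.
      Poly_Mapping.single (singular_face p k \<sigma>) (Poly_Mapping.lookup (c + d) \<sigma>)) =
    (\<Sum>\<sigma>\<in>Poly_Mapping.keys c. \<Sum>k\<le>p.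
      Poly_Mapping.single (singular_face p k \<sigma>) (Poly_Mapping.lookup c \<sigma>)) +
    (\<Sum>\<sigma>\<in>Poly_Mapping.keys d. \<Sum>k\<le>p.
      Poly_Mapping.single (singular_face p k \<sigma>) (Poly_Mapping.lookup d \<sigma>))"
    \<comment> \<open>Keys may cancel in \<open>c + d\<close>, which this rule accounts for. Keeping
      \<open>+\<close> on bits instead of xor lets \<open>single_add\<close> apply.\<close>
    by (rule setsum_keys_plus_distrib)
      (simp_all add: single_add sum.distrib del: add_bit_eq_xor)
  with False show ?thesis by (simp add: mod2_boundary_def)
qed (simp add: mod2_boundary_def)

lemma mod2_boundary_diff: "mod2_boundary p (c - d) = mod2_boundary p c - mod2_boundary p d"
  using mod2_boundary_add[of p c "- d"] by (metis mod2_chain_uminus diff_conv_add_uminus)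

lemma mod2_chains_diff:
  "c \<in> mod2_chains p X \<Longrightarrow> d \<in> mod2_chains p X \<Longrightarrow> c - d \<in> mod2_chains p X"
  unfolding mod2_chains_def using keys_diff[of c d] by blast

lemma zero_in_mod2_boundaries [simp]: "0 \<in> mod2_boundaries p X"
proof -
  have "0 = mod2_boundary (Suc p) 0" "0 \<in> mod2_chains (Suc p) X"
    by (auto simp: mod2_boundary_def mod2_chains_def)
  then show ?thesis unfolding mod2_boundaries_def by blast
qed

lemma mod2_boundaries_diff:
  "c \<in> mod2_boundaries p X \<Longrightarrow> d \<in> mod2_boundaries p X \<Longrightarrow> c - d \<in> mod2_boundaries p X"
  unfolding mod2_boundaries_def by (auto simp: mod2_chains_diff simp flip: mod2_boundary_diff)

text \<open>Boundaries are closed under differences, so replacing \<open>c\<close> by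
  \<open>d\<close> shifts \<open>e - c\<close> by a boundary and does not affect membership.\<close>

lemma mod2_class_eq:
  assumes "c - d \<in> mod2_boundaries p X"
  shows "mod2_class p X c = mod2_class p X d"
proof -
  have "e - c \<in> mod2_boundaries p X \<longleftrightarrow> e - d \<in> mod2_boundaries p X" for e
    using mod2_boundaries_diff[OF _ assms, of "e - d"]
      mod2_boundaries_diff[OF _ mod2_boundaries_diff[OF zero_in_mod2_boundaries assms], of "e - c"]
    by (auto simp: algebra_simps)
  then show ?thesis by (simp add: mod2_class_def)
qed

lemma mod2_class_eqD:
  assumes "mod2_class p X c = mod2_class p X d" "c \<in> mod2_cycles p X"
  shows "c - d \<in> mod2_boundaries p X"
proof -
  have "c \<in> mod2_class p X c" using assms(2) by (simp add: mod2_class_def)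
  then show ?thesis unfolding assms(1) by (simp add: mod2_class_def)
qed

lemma mod2_chains_mono:
  "S \<subseteq> T \<Longrightarrow> mod2_chains p (subtopology X S) \<subseteq> mod2_chains p (subtopology X T)"
  unfolding mod2_chains_def using singular_simplex_mono by blast

lemma mod2_boundaries_mono:
  "S \<subseteq> T \<Longrightarrow> mod2_boundaries p (subtopology X S) \<subseteq> mod2_boundaries p (subtopology X T)"
  unfolding mod2_boundaries_def by (intro image_mono mod2_chains_mono)

text \<open>\<open>mod2_incl\<close> takes a union over all representatives. Boundaries in
  \<open>S\<close> remain boundaries in \<open>T\<close>, so the members of the union coincide, and
  \<open>c\<close> itself makes it nonempty.\<close>

lemma mod2_incl_class:
  assumes "S \<subseteq> T" "c \<in> mod2_cycles p (subtopology X S)"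
  shows "mod2_incl p (subtopology X T) (mod2_class p (subtopology X S) c)
    = mod2_class p (subtopology X T) c"
proof -
  have "mod2_class p (subtopology X T) d = mod2_class p (subtopology X T) c"
    if "d \<in> mod2_class p (subtopology X S) c" for d
    using that mod2_boundaries_mono[OF assms(1)]
    by (intro mod2_class_eq) (auto simp: mod2_class_def)
  moreover have "c \<in> mod2_class p (subtopology X S) c"
    using assms(2) by (simp add: mod2_class_def)
  ultimately show ?thesis unfolding mod2_incl_def by blast
qed

section \<open>Degree zero: points, paths and components\<close>

lemma mod2_cycles_0 [simp]: "mod2_cycles 0 X = mod2_chains 0 X"
  by (auto simp: mod2_cycles_def mod2_boundary_def)

abbreviation point_chain :: "'a \<Rightarrow> 'a mod2_chain" where
  "point_chain x \<equiv> Poly_Mapping.single (point_simplex x) 1"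

lemma point_chain_in_mod2_chains:
  assumes "x \<in> topspace X"
  shows "point_chain x \<in> mod2_chains 0 X"
proof -
  have "continuous_map (subtopology (powertop_real UNIV) (standard_simplex 0)) X (point_simplex x)"
    by (rule continuous_map_eq[where f = "\<lambda>_. x"])
      (use assms in \<open>auto simp: point_simplex_def\<close>)
  then show ?thesis
    by (simp add: mod2_chains_def singular_simplex_def point_simplex_def)
qed

lemma point_chain_diff_boundary:
  assumes "path_component_of X x y"
  shows "point_chain x - point_chain y \<in> mod2_boundaries 0 X"
proof -
  obtain g where g: "pathin X g" "g 0 = x" "g 1 = y"
    using assms by (auto simp: path_component_of_def)
  \<comment> \<open>Coordinate 0 parametrizes the 1-simplex by \<open>{0..1}\<close>. Face 0 sets it
    to 0 and face 1 leaves it at 1, so the faces of \<open>\<sigma>\<close> are the start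
    \<open>x\<close> and the end \<open>y\<close> of the path.\<close>
  define \<sigma> where "\<sigma> = restrict (\<lambda>v. g (v 0)) (standard_simplex 1)"
  let ?S = "subtopology (powertop_real UNIV) (standard_simplex 1)"
  have "continuous_map ?S (top_of_set {0..1}) (\<lambda>v. v 0)"
    unfolding continuous_map_in_subtopology
    by (auto intro!: continuous_map_from_subtopology continuous_map_product_projection)
      (auto simp: standard_simplex_def)
  then have "continuous_map ?S X (g \<circ> (\<lambda>v. v 0))"
    using g(1) unfolding pathin_def by (rule continuous_map_compose)
  then have "continuous_map ?S X \<sigma>"
    by (rule continuous_map_eq) (auto simp: \<sigma>_def)
  then have "Poly_Mapping.single \<sigma> 1 \<in> mod2_chains (Suc 0) X"
    by (simp add: mod2_chains_def singular_simplex_def \<sigma>_def)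
  moreover have face: "singular_face (Suc 0) k \<sigma> =
      restrict (\<lambda>v. g (simplical_face k v 0)) (standard_simplex 0)" if "k \<le> Suc 0" for k
    using that simplical_face_in_standard_simplex[of "Suc 0" k]
    by (auto simp: singular_face_def \<sigma>_def restrict_def fun_eq_iff)
  have "singular_face (Suc 0) 0 \<sigma> = point_simplex x"
    and "singular_face (Suc 0) (Suc 0) \<sigma> = point_simplex y"
    using g(2,3)
    by (auto simp: face point_simplex_def standard_simplex_0 simplical_face_def
        simp del: One_nat_def intro!: restrict_ext)
  then have "mod2_boundary (Suc 0) (Poly_Mapping.single \<sigma> 1) = point_chain x + point_chain y"
    by (simp add: mod2_boundary_def)
  \<comment> \<open>Modulo 2 the sum and the difference of the two endpoints agree.\<close>
  then have "point_chain x - point_chain y = mod2_boundary (Suc 0) (Poly_Mapping.single \<sigma> 1)"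
    by (metis mod2_chain_uminus diff_conv_add_uminus)
  ultimately show ?thesis unfolding mod2_boundaries_def by blast
qed

lemma mod2_class_point_eq:
  "path_component_of X x y \<Longrightarrow> mod2_class 0 X (point_chain x) = mod2_class 0 X (point_chain y)"
  by (intro mod2_class_eq point_chain_diff_boundary)

text \<open>Any two points of a path component are joined by a path, so the choice made in
  \<open>component_class\<close> is immaterial; this allows the origin as representative of the
  cavity.\<close>

lemma component_class_eq:
  assumes "C \<in> path_components_of X" "x \<in> C"
  shows "component_class X C = mod2_class 0 X (point_chain x)"
proof -
  have "(SOME x. x \<in> C) \<in> C" using assms(2) by (rule someI)
  then have "path_component_of X (SOME x. x \<in> C) x"
    using assms path_connectedin_path_components_of[OF assms(1)]
    by (meson path_component_of)
  then show ?thesis unfolding component_class_def by (rule mod2_class_point_eq)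
qed

section \<open>Parity of 0-chains in a clopen set\<close>

definition point_parity :: "'a set \<Rightarrow> 'a mod2_chain \<Rightarrow> bit" where
  "point_parity A c = (\<Sum>\<sigma>\<in>Poly_Mapping.keys c.
     if \<sigma> (\<lambda>j. if j = 0 then 1 else 0) \<in> A then Poly_Mapping.lookup c \<sigma> else 0)"

lemma point_parity_add: "point_parity A (c + d) = point_parity A c + point_parity A d"
  unfolding point_parity_def
  by (intro setsum_keys_plus_distrib[where f = "\<lambda>\<sigma> u. if _ \<sigma> then u else 0"]) auto

lemma point_parity_single [simp]:
  "point_parity A (Poly_Mapping.single \<sigma> u) = (if \<sigma> (\<lambda>j. if j = 0 then 1 else 0) \<in> A then u else 0)"
  by (auto simp: point_parity_def)

lemma point_parity_diff: "point_parity A (c - d) = point_parity A c - point_parity A d"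
  using point_parity_add[of A "c - d" d] by (metis diff_add_cancel add_diff_cancel_right')

lemma point_parity_sum: "point_parity A (sum f I) = (\<Sum>i\<in>I. point_parity A (f i))"
proof -
  have "point_parity A 0 = 0" by (simp add: point_parity_def)
  then show ?thesis
    by (induction I rule: infinite_finite_induct)
      (simp_all add: point_parity_add del: add_bit_eq_xor)
qed

text \<open>The 1-simplex is connected, so its image lies inside the clopen \<open>A\<close> or
  outside it. Both faces are then counted or both omitted, and their equal coefficients cancel
  modulo 2.\<close>

lemma point_parity_boundary:
  assumes "openin X A" "closedin X A" "c \<in> mod2_boundaries 0 X"
  shows "point_parity A c = 0"
proof -
  \<comment> \<open>The only point of the standard 0-simplex; evaluating a singular 0-simplex there
    recovers the point it represents.\<close>
  let ?e = "\<lambda>j::nat. if j = 0 then 1 else (0::real)"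
  obtain d where d: "d \<in> mod2_chains (Suc 0) X" "c = mod2_boundary (Suc 0) d"
    using assms(3) by (auto simp: mod2_boundaries_def)
  have "point_parity A (\<Sum>k\<le>Suc 0. Poly_Mapping.single (singular_face (Suc 0) k \<sigma>) (Poly_Mapping.lookup d \<sigma>)) = 0"
    if "\<sigma> \<in> Poly_Mapping.keys d" for \<sigma>
  proof -
    have \<sigma>: "continuous_map (subtopology (powertop_real UNIV) (standard_simplex (Suc 0))) X \<sigma>"
      using that d(1) by (auto simp: mod2_chains_def singular_simplex_def)
    have "connectedin (subtopology (powertop_real UNIV) (standard_simplex (Suc 0)))
        (standard_simplex (Suc 0))"
      by (simp add: connectedin_subtopology connectedin_standard_simplex)
    then have conn: "connectedin X (\<sigma> ` standard_simplex (Suc 0))"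
      using \<sigma> connectedin_continuous_map_image by blast
    have "\<sigma> ` standard_simplex (Suc 0) \<subseteq> A \<or> disjnt (\<sigma> ` standard_simplex (Suc 0)) A"
      using connectedin_clopen_cases[OF conn assms(2,1)] .
    moreover have "singular_face (Suc 0) k \<sigma> ?e \<in> \<sigma> ` standard_simplex (Suc 0)"
      if "k \<le> Suc 0" for k
      using that simplical_face_in_standard_simplex[of "Suc 0" k ?e]
      by (auto simp: singular_face_def)
    ultimately have "singular_face (Suc 0) 0 \<sigma> ?e \<in> A \<longleftrightarrow> singular_face (Suc 0) (Suc 0) \<sigma> ?e \<in> A"
      by (fastforce simp: disjnt_iff)
    then show ?thesis by (auto simp: point_parity_add)
  qed
  then show ?thesis
    unfolding d(2) mod2_boundary_def by (simp add: point_parity_sum)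
qed

section \<open>Older classes in sublevel filtrations\<close>

lemma sublevel_filtration_incl:
  assumes "s \<le> t" "c \<in> mod2_chains 0 (sublevel_filtration \<Omega> f s)"
  shows "mod2_incl 0 (sublevel_filtration \<Omega> f t) (mod2_class 0 (sublevel_filtration \<Omega> f s) c)
    = mod2_class 0 (sublevel_filtration \<Omega> f t) c"
  using assms unfolding sublevel_filtration_def by (intro mod2_incl_class) auto

text \<open>Every 0-chain is a cycle and inclusion keeps representatives, so classes of chains from
  levels below \<open>\<beta>\<close> suffice.\<close>

lemma older_classes_0:
  assumes "\<beta> \<le> t"
  shows "older_classes 0 (sublevel_filtration \<Omega> f) \<beta> t =
    (\<Union>s\<in>{..<\<beta>}. mod2_class 0 (sublevel_filtration \<Omega> f t) ` mod2_chains 0 (sublevel_filtration \<Omega> f s))"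
  using assms unfolding older_classes_def mod2_homology_def
  by (simp add: image_image sublevel_filtration_incl)

text \<open>Parity in \<open>A\<close> tells the point from older chains: it is 1 for the point and
  0 for chains from levels below \<open>\<beta>\<close>, while homologous chains at level
  \<open>t\<close> have equal parity.\<close>

lemma point_class_not_older:
  assumes "\<beta> \<le> t" "x \<in> \<Omega>" "f x \<le> t" "x \<in> A"
    and "openin (sublevel_filtration \<Omega> f t) A" "closedin (sublevel_filtration \<Omega> f t) A"
    and above: "\<And>y. y \<in> A \<Longrightarrow> \<beta> \<le> f y"
  shows "mod2_class 0 (sublevel_filtration \<Omega> f t) (point_chain x)
    \<notin> older_classes 0 (sublevel_filtration \<Omega> f) \<beta> t"
proof
  let ?F = "sublevel_filtration \<Omega> f" and ?e = "\<lambda>j::nat. if j = 0 then 1 else (0::real)"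
  assume "mod2_class 0 (?F t) (point_chain x) \<in> older_classes 0 ?F \<beta> t"
  then obtain s c where s: "s < \<beta>" and c: "c \<in> mod2_chains 0 (?F s)"
    and eq: "mod2_class 0 (?F t) (point_chain x) = mod2_class 0 (?F t) c"
    by (auto simp: older_classes_0[OF assms(1)])
  have "point_chain x - c \<in> mod2_boundaries 0 (?F t)"
    using eq assms(2,3) by (intro mod2_class_eqD)
      (auto intro!: point_chain_in_mod2_chains simp: sublevel_filtration_def)
  then have "point_parity A (point_chain x - c) = 0"
    using assms(5,6) by (intro point_parity_boundary)
  moreover have "point_parity A c = 0"
    unfolding point_parity_def
  proof (rule sum.neutral, safe)
    fix \<sigma> assume "\<sigma> \<in> Poly_Mapping.keys c"
    then have "continuous_map (subtopology (powertop_real UNIV) (standard_simplex 0)) (?F s) \<sigma>"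
      using c by (auto simp: mod2_chains_def singular_simplex_def)
    then have "\<sigma> ?e \<in> topspace (?F s)"
      using continuous_map_image_subset_topspace by (fastforce simp: standard_simplex_0)
    then have "\<sigma> ?e \<notin> A" using above[of "\<sigma> ?e"] s by (auto simp: sublevel_filtration_def)
    then show "(if \<sigma> ?e \<in> A then Poly_Mapping.lookup c \<sigma> else 0) = 0" by simp
  qed
  moreover have "point_parity A (point_chain x) = 1"
    using assms(4) by (simp add: point_simplex_def standard_simplex_0)
  ultimately show False by (simp add: point_parity_diff)
qed

text \<open>The point \<open>y\<close> is present already at its own level \<open>f y\<close>, which
  is the witness for a level below \<open>\<beta>\<close>.\<close>

lemma point_class_older:
  assumes "\<beta> \<le> t" "y \<in> \<Omega>" "f y < \<beta>" "path_component_of (sublevel_filtration \<Omega> f t) x y"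
  shows "mod2_class 0 (sublevel_filtration \<Omega> f t) (point_chain x)
    \<in> older_classes 0 (sublevel_filtration \<Omega> f) \<beta> t"
  unfolding older_classes_0[OF assms(1)] mod2_class_point_eq[OF assms(4)]
  using assms(2,3) by (intro UN_I[of "f y"] imageI point_chain_in_mod2_chains)
    (auto simp: sublevel_filtration_def)

section \<open>Distance to the annulus\<close>

lemma infdist_annulus_eq_0: "a \<le> norm x \<Longrightarrow> norm x \<le> b \<Longrightarrow> infdist x (annulus a b) = 0"
  by (simp add: annulus_def)

text \<open>A nearest point lies on the inner circle in the direction of \<open>x\<close>; the
  reverse triangle inequality excludes closer ones.\<close>

lemma infdist_annulus_hole:
  assumes "0 < a" "a \<le> b" "norm x \<le> a"
  shows "infdist x (annulus a b) = a - norm x"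
proof (rule antisym)
  \<comment> \<open>The origin has no direction of its own, so a fixed unit vector is used
    there.\<close>
  define u where "u = (if x = 0 then axis 1 1 else x /\<^sub>R norm x)"
  have u: "norm u = 1" "x = norm x *\<^sub>R u" by (auto simp: u_def)
  have "dist x (a *\<^sub>R u) = norm ((norm x - a) *\<^sub>R u)"
    unfolding dist_norm scaleR_diff_left by (subst u(2)) (rule refl)
  then have "dist x (a *\<^sub>R u) = a - norm x" using assms(3) u(1) by simp
  moreover have "a *\<^sub>R u \<in> annulus a b" using assms u(1) by (simp add: annulus_def)
  ultimately show "infdist x (annulus a b) \<le> a - norm x" by (metis infdist_le)
  have "a - norm x \<le> dist x d" if "d \<in> annulus a b" for d
    using that norm_triangle_sub[of d x] by (simp add: annulus_def dist_norm norm_minus_commute)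
  \<comment> \<open>On the empty set \<open>infdist\<close> is 0 by convention, so nonemptiness is
    needed to read it as an infimum.\<close>
  then show "a - norm x \<le> infdist x (annulus a b)"
    using \<open>a *\<^sub>R u \<in> annulus a b\<close> by (subst infdist_notempty) (auto intro: cINF_greatest)
qed

section \<open>The indicator and the hole in its sublevel sets\<close>

context
  fixes \<Phi> :: "real \<Rightarrow> real" and \<Omega> :: "(real ^ 2) set" and a b :: real
  assumes config: "annular_configuration \<Phi> \<Omega> a b"
begin

private abbreviation (input) "f \<equiv> ideal_indicator \<Phi> (annulus a b)"
private abbreviation (input) "F \<equiv> indicator_filtration \<Phi> \<Omega> a b"
private abbreviation (input) "H \<equiv> {x :: real ^ 2. norm x < a}"

lemma annular_radii: "0 < a" "a < b"
  using config by (auto simp: annular_configuration_def)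

lemma topspace_indicator_filtration: "topspace (F t) = {x \<in> \<Omega>. f x \<le> t}"
  by (simp add: indicator_filtration_def sublevel_filtration_def)

lemma disc_in_window: "norm x \<le> b \<Longrightarrow> x \<in> \<Omega>"
  using config interior_subset by (fastforce simp: annular_configuration_def)

text \<open>Phrased with points of \<open>\<Omega>\<close> since \<open>\<Phi>\<close> is known to
  be decreasing only on distances attained in the window.\<close>

lemma indicator_less:
  assumes "x \<in> \<Omega>" "y \<in> \<Omega>" "infdist x (annulus a b) < infdist y (annulus a b)"
  shows "f y < f x"
  using config assms by (auto simp: annular_configuration_def ideal_indicator_def monotone_on_def)

text \<open>The point \<open>a *\<^sub>R axis 1 1\<close> of the annulus realizes distance 0 and the
  value \<open>\<Phi> 0 = 1\<close>; larger distances have smaller values.\<close>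

lemma indicator_le_1: "x \<in> \<Omega> \<Longrightarrow> f x \<le> 1"
  using indicator_less[of "a *\<^sub>R axis 1 1" x] disc_in_window[of "a *\<^sub>R axis 1 1"] annular_radii config
    infdist_nonneg[of x "annulus a b"] infdist_annulus_eq_0[of a "a *\<^sub>R axis 1 1" b]
  by (cases "infdist x (annulus a b) = 0") (auto simp: annular_configuration_def ideal_indicator_def)

lemma indicator_0: "f 0 = \<Phi> a"
  using infdist_annulus_hole[of a b 0] annular_radii by (simp add: ideal_indicator_def)

lemma indicator_less_in_hole:
  assumes "norm x < norm y" "norm y \<le> a"
  shows "f x < f y"
  using assms annular_radii disc_in_window
  by (intro indicator_less) (auto simp: infdist_annulus_hole)

lemma indicator_mono_in_hole:
  assumes "norm x \<le> norm y" "norm y \<le> a"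
  shows "f x \<le> f y"
  using indicator_less_in_hole[OF _ assms(2), of x] assms annular_radii
  by (cases "norm x = norm y") (auto simp: ideal_indicator_def infdist_annulus_hole)

lemma indicator_on_annulus: "a \<le> norm x \<Longrightarrow> norm x \<le> b \<Longrightarrow> f x = 1"
  using config by (simp add: ideal_indicator_def infdist_annulus_eq_0 annular_configuration_def)

lemma center_level_less_1: "\<Phi> a < 1"
  using indicator_less_in_hole[of 0 "a *\<^sub>R axis 1 1"] indicator_on_annulus[of "a *\<^sub>R axis 1 1"] indicator_0 annular_radii
  by simp

text \<open>Below level 1 the annulus is absent, so no point has norm exactly \<open>a\<close>; the
  open and the closed disc of radius \<open>a\<close> then cut out the same subset.\<close>

lemma hole_clopen:
  assumes "t < 1"
  shows "openin (F t) (H \<inter> topspace (F t))" "closedin (F t) (H \<inter> topspace (F t))"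
proof -
  have F: "F t = top_of_set (topspace (F t))"
    by (simp add: indicator_filtration_def sublevel_filtration_def)
  have "open H" by (intro open_Collect_less continuous_intros)
  then show "openin (F t) (H \<inter> topspace (F t))"
    by (subst F) (metis openin_open_Int Int_commute)
  have "norm x \<noteq> a" if "x \<in> topspace (F t)" for x
    using that indicator_on_annulus[of x] annular_radii assms by (auto simp: topspace_indicator_filtration)
  then have "H \<inter> topspace (F t) = topspace (F t) \<inter> {x. norm x \<le> a}" by force
  moreover have "closed {x :: real ^ 2. norm x \<le> a}"
    by (intro closed_Collect_le continuous_intros)
  ultimately show "closedin (F t) (H \<inter> topspace (F t))"
    by (subst F) (metis closedin_closed_Int)
qed

text \<open>The closed disc about the origin through \<open>x\<close> is convex, and
  \<open>f\<close> does not exceed \<open>f x\<close> on it, so it stays inside the sublevel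
  set.\<close>

lemma hole_path_component:
  assumes "x \<in> topspace (F t)" "norm x < a"
  shows "path_component_of (F t) x 0"
proof -
  have "cball 0 (norm x) \<subseteq> topspace (F t)"
  proof
    fix y :: "real ^ 2" assume "y \<in> cball 0 (norm x)"
    then show "y \<in> topspace (F t)"
      using indicator_mono_in_hole[of y x] assms annular_radii disc_in_window[of y]
      by (auto simp: topspace_indicator_filtration)
  qed
  then have "path_connectedin (F t) (cball 0 (norm x))"
    by (simp add: topspace_indicator_filtration indicator_filtration_def sublevel_filtration_def
        path_connectedin_subtopology convex_imp_path_connected)
  then show ?thesis unfolding path_component_of by (intro exI[of _ "cball 0 (norm x)"]) auto
qed

section \<open>Birth and death of the class of the origin\<close>

private abbreviation (input) "C\<^sub>0 \<equiv> path_component_of_set (F (\<Phi> a)) 0"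

lemma center_in_level: "\<Phi> a \<le> t \<Longrightarrow> 0 \<in> topspace (F t)"
  using disc_in_window[of 0] annular_radii indicator_0 by (simp add: topspace_indicator_filtration)

text \<open>A path component is connected, so one containing 0 cannot leave the hole, which is
  clopen because \<open>\<Phi> a < 1\<close>.\<close>

lemma center_component:
  shows "C\<^sub>0 \<in> path_components_of (F (\<Phi> a))" "0 \<in> C\<^sub>0" "C\<^sub>0 \<subseteq> H"
proof -
  show 1: "C\<^sub>0 \<in> path_components_of (F (\<Phi> a))"
    using center_in_level by (simp add: path_component_in_path_components_of)
  show 2: "0 \<in> C\<^sub>0" using center_in_level by (simp add: path_component_of_refl)
  have "connectedin (F (\<Phi> a)) C\<^sub>0"
    using 1 path_connectedin_path_components_of path_connectedin_imp_connectedin by blast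
  from connectedin_clopen_cases[OF this hole_clopen(2,1)[OF center_level_less_1]]
  have "C\<^sub>0 \<subseteq> H \<inter> topspace (F (\<Phi> a))"
    using 2 annular_radii(1) center_in_level[OF order_refl] unfolding disjnt_iff by fastforce
  then show "C\<^sub>0 \<subseteq> H" by blast
qed

lemma center_class_not_older:
  assumes "\<Phi> a \<le> t" "t < 1"
  shows "mod2_class 0 (F t) (point_chain 0) \<notin> older_classes 0 F (\<Phi> a) t"
  unfolding indicator_filtration_def
proof (rule point_class_not_older)
  show "openin (sublevel_filtration \<Omega> f t) (H \<inter> topspace (F t))"
    "closedin (sublevel_filtration \<Omega> f t) (H \<inter> topspace (F t))"
    using hole_clopen[OF assms(2)] by (simp_all add: indicator_filtration_def)
  \<comment> \<open>Within the hole \<open>f\<close> is least at the origin, so nothing there is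
    present below level \<open>\<Phi> a\<close>.\<close>
  show "\<Phi> a \<le> f y" if "y \<in> H \<inter> topspace (F t)" for y
    using indicator_mono_in_hole[of 0 y] indicator_0 that by simp
  show "0 \<in> H \<inter> topspace (F t)" using annular_radii center_in_level assms by simp
qed (use assms center_in_level in \<open>auto simp: topspace_indicator_filtration\<close>)

lemma center_class_older: "mod2_class 0 (F 1) (point_chain 0) \<in> older_classes 0 F (\<Phi> a) 1"
proof -
  obtain z where z: "z \<in> \<Omega>" "infdist z (annulus a b) > a"
    using config by (auto simp: annular_configuration_def)
  then have "f z < \<Phi> a"
    using indicator_less[of 0 z] disc_in_window[of 0] annular_radii infdist_annulus_hole[of a b 0]
      indicator_0 by simp
  moreover have "path_component_of (F 1) 0 z"
  proof -
    \<comment> \<open>Level 1 is the maximum of \<open>f\<close>, so no constraint remains and path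
      connectedness of the window joins 0 to \<open>z\<close>.\<close>
    have "{x \<in> \<Omega>. f x \<le> 1} = \<Omega>" using indicator_le_1 by auto
    then have "F 1 = top_of_set \<Omega>" by (simp add: indicator_filtration_def sublevel_filtration_def)
    moreover have "path_connected \<Omega>" using config by (simp add: annular_configuration_def)
    ultimately show ?thesis
      using z(1) disc_in_window[of 0] annular_radii
      by (auto simp: path_component_of path_connectedin_subtopology intro!: exI[of _ \<Omega>])
  qed
  ultimately show ?thesis
    using z(1) center_level_less_1 unfolding indicator_filtration_def
    by (intro point_class_older) auto
qed

text \<open>A component inside the hole contains the origin, so its class is that of the origin.
  Birth strictly above \<open>\<Phi> a\<close> is impossible, since the origin itself was present
  earlier.\<close>

lemma cavity_component_iff: "cavity_component a F C \<beta> \<longleftrightarrow> C = C\<^sub>0 \<and> \<beta> = \<Phi> a"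
proof
  assume C: "cavity_component a F C \<beta>"
  then obtain x where x: "x \<in> C"
    using nonempty_path_components_of unfolding cavity_component_def by blast
  with C have xF: "x \<in> topspace (F \<beta>)" "norm x < a"
    using path_components_of_subset unfolding cavity_component_def by blast+
  note x0 = hole_path_component[OF this]
  have 0: "0 \<in> C"
    using C x path_component_of_equiv x0 unfolding cavity_component_def path_components_of_def
    by (auto intro: path_component_of_trans)
  have "\<Phi> a \<le> \<beta>"
    using indicator_mono_in_hole[of 0 x] indicator_0 xF by (simp add: topspace_indicator_filtration)
  moreover have "\<not> \<Phi> a < \<beta>"
  proof
    assume "\<Phi> a < \<beta>"
    then have "mod2_class 0 (F \<beta>) (point_chain 0) \<in> older_classes 0 F \<beta> \<beta>"
      using path_component_of_refl[of "F \<beta>" 0] center_in_level disc_in_window[of 0] annular_radii indicator_0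
      unfolding indicator_filtration_def by (intro point_class_older[of _ _ 0]) auto
    then show False
      using C component_class_eq[of C "F \<beta>", OF _ 0] by (simp add: cavity_component_def born_at_def)
  qed
  ultimately have "\<beta> = \<Phi> a" by simp
  moreover have "C = C\<^sub>0"
    using C 0 calculation unfolding cavity_component_def path_components_of_def
    by (auto simp: path_component_of_equiv)
  ultimately show "C = C\<^sub>0 \<and> \<beta> = \<Phi> a" by simp
next
  assume "C = C\<^sub>0 \<and> \<beta> = \<Phi> a"
  then show "cavity_component a F C \<beta>"
    using center_component component_class_eq[OF center_component(1,2)]
      center_class_not_older[OF order_refl center_level_less_1]
      point_chain_in_mod2_chains[OF center_in_level[OF order_refl]]
    by (simp add: cavity_component_def born_at_def mod2_homology_def)
qed

text \<open>The class is not older before level 1 and is older at level 1, which excludes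
  \<open>\<delta> < 1\<close> and \<open>1 < \<delta>\<close>. Uniqueness is what evaluates the
  definite description in \<open>cavity_death\<close>.\<close>

lemma dies_at_center_iff: "dies_at 0 F (component_class (F (\<Phi> a)) C\<^sub>0) (\<Phi> a) \<delta> \<longleftrightarrow> \<delta> = 1"
proof -
  have incl: "mod2_incl 0 (F t) (component_class (F (\<Phi> a)) C\<^sub>0) = mod2_class 0 (F t) (point_chain 0)"
    if "\<Phi> a \<le> t" for t
    unfolding component_class_eq[OF center_component(1,2)]
    using that point_chain_in_mod2_chains[OF center_in_level[OF order_refl]]
    unfolding indicator_filtration_def by (rule sublevel_filtration_incl)
  show ?thesis
  proof
    assume d: "dies_at 0 F (component_class (F (\<Phi> a)) C\<^sub>0) (\<Phi> a) \<delta>"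
    have "\<not> \<delta> < 1"
      using d incl[of \<delta>] center_class_not_older[of \<delta>] by (auto simp: dies_at_def)
    moreover have "\<not> 1 < \<delta>"
      using d incl[of 1] center_class_older center_level_less_1
      by (auto simp: dies_at_def dest!: bspec[where x = 1])
    ultimately show "\<delta> = 1" by simp
  next
    assume "\<delta> = 1"
    then show "dies_at 0 F (component_class (F (\<Phi> a)) C\<^sub>0) (\<Phi> a) \<delta>"
      using incl center_class_not_older center_class_older center_level_less_1 by (auto simp: dies_at_def)
  qed
qed

section \<open>The cavity bar and its dependence on the hole radius\<close>

lemma cavity_birth_eq: "cavity_birth a F = \<Phi> a"
  by (simp add: cavity_birth_def cavity_component_iff)

lemma cavity_death_eq: "cavity_death a F = 1"
  by (simp add: cavity_death_def cavity_component_iff dies_at_center_iff)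

lemma cavity_persistence_eq: "cavity_persistence a F = 1 - \<Phi> a"
  by (simp add: cavity_persistence_def cavity_birth_eq cavity_death_eq)

lemma cavity_finite_bar:
  "cavity_component a F C \<beta> \<Longrightarrow> finite_bar 0 F (component_class (F \<beta>) C) (\<Phi> a) 1"
  using dies_at_center_iff[of 1] cavity_component_iff[of C \<beta>]
  by (auto simp: finite_bar_def cavity_component_def)

lemma cavity_component_ex1: "\<exists>!(C, \<beta>). cavity_component a F C \<beta>"
  by (auto simp: cavity_component_iff intro!: ex1I[of _ "(C\<^sub>0, \<Phi> a)"])

text \<open>A point of norm \<open>a - r\<close> and the origin realize the distances
  \<open>r\<close> and \<open>a\<close> in the window, so strict monotonicity of
  \<open>\<Phi>\<close> applies to them.\<close>

lemma profile_less_at_hole_radius: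
  assumes "0 \<le> r" "r < a"
  shows "\<Phi> a < \<Phi> r"
  using indicator_less[of "(a - r) *\<^sub>R axis 1 1" 0] assms annular_radii disc_in_window[of 0]
    disc_in_window[of "(a - r) *\<^sub>R axis 1 1"] indicator_0
  by (simp add: infdist_annulus_hole ideal_indicator_def)

end

theorem proposition3p4:
  fixes \<Phi> :: "real \<Rightarrow> real" and \<Omega> :: "(real ^ 2) set" and a b :: real
  assumes "annular_configuration \<Phi> \<Omega> a b"
  shows "(\<exists>!(C, \<beta>). cavity_component a (indicator_filtration \<Phi> \<Omega> a b) C \<beta>) \<and>
    (\<forall>C \<beta>. cavity_component a (indicator_filtration \<Phi> \<Omega> a b) C \<beta> \<longrightarrow>
       finite_bar 0 (indicator_filtration \<Phi> \<Omega> a b)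
         (component_class (indicator_filtration \<Phi> \<Omega> a b \<beta>) C)
         (cavity_birth a (indicator_filtration \<Phi> \<Omega> a b))
         (cavity_death a (indicator_filtration \<Phi> \<Omega> a b))) \<and>
    cavity_birth a (indicator_filtration \<Phi> \<Omega> a b) = \<Phi> a \<and>
    cavity_death a (indicator_filtration \<Phi> \<Omega> a b) = 1 \<and>
    cavity_persistence a (indicator_filtration \<Phi> \<Omega> a b) = 1 - \<Phi> a \<and>
    (\<forall>\<Omega>' a' b'. annular_configuration \<Phi> \<Omega>' a' b' \<and> a < a' \<longrightarrow>
       cavity_persistence a (indicator_filtration \<Phi> \<Omega> a b)
         < cavity_persistence a' (indicator_filtration \<Phi> \<Omega>' a' b'))"
proof -
  \<comment> \<open>The comparison takes place in the configuration with the larger hole, where both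
    distances \<open>a\<close> and \<open>a'\<close> are attained.\<close>
  have "\<Phi> a' < \<Phi> a" if "annular_configuration \<Phi> \<Omega>' a' b'" "a < a'" for \<Omega>' a' b'
    using profile_less_at_hole_radius[OF that(1), of a] annular_radii(1)[OF assms] that(2) by simp
  then show ?thesis
    using cavity_component_ex1[OF assms] cavity_finite_bar[OF assms]
    by (auto simp: assms cavity_birth_eq cavity_death_eq cavity_persistence_eq)
qed

end
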